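(* Let $V$ be a finite vertex set with $|V|\ge3$, let $\mathcal K=(V,\binom V2)$ be the complete graph on $V$, and let $\mathcal G=(V,E,w)$ be a weighted graph with weighted Laplacian $\boldsymbol L_{\mathcal G}$. Then, for $0\le\varepsilon<1$, the weighted graph $\mathcal G$ is a spectral sparsifier of $\mathcal K$, i.e. $$(1-\varepsilon)\boldsymbol L_{\mathcal K}\preceq\boldsymbol L_{\mathcal G}\preceq(1+\varepsilon)\boldsymbol L_{\mathcal K},$$ if and only if the edges $E$ and weights $w$ satisfy the $L_2$ Marcinkiewicz--Zygmund inequality $$(1-\varepsilon)\|f\|_{L_2}^2\le\sum_{e\in E}w_e|f(e)|^2\le(1+\varepsilon)\|f\|_{L_2}^2\quad\text{for all }f\in\mathcal F_{\mathcal K}.$$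
   Context: $\binom V2$ is the set of two-element subsets of $V$, and $\preceq$ is the Loewner order. A weighted graph $\mathcal G=(V,E,w)$ has edge set $E\subseteq\binom V2$ and weights $w:E\to(0,\infty)$. Its weighted Laplacian is $\boldsymbol L_{\mathcal G}=\sum_{\{u,v\}\in E}w_{\{u,v\}}(\boldsymbol e_u-\boldsymbol e_v)(\boldsymbol e_u-\boldsymbol e_v)^\top\in\mathbb R^{|V|\times|V|}$. The complete graph has Laplacian $\boldsymbol L_{\mathcal K}=|V|\boldsymbol I-\boldsymbol 1_{|V|}\boldsymbol 1_{|V|}^\top$. With an arbitrary fixed ordering of the endpoints of each edge, the function space is $$\mathcal F_{\mathcal K}=\Big\{f_{\boldsymbol a}:\tbinom V2\to\mathbb R,\ f_{\boldsymbol a}(\{u,v\})=\frac{a_u-a_v}{\sqrt{|V|}}\ :\ \boldsymbol a\in\mathbb R^{|V|},\ \sum_{u\in V}a_u=0\Big\},$$ where the edge set $\binom V2$ carries the counting measure, so $\|f\|_{L_2}^2=\sum_{e\in\binom V2}|f(e)|^2$. *)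

theory Defs
  imports "HOL-Analysis.Analysis" "HOL-Library.Ramsey" "HOL-Library.FuncSet"
begin

text \<open>The vertex set \<open>V\<close> is a finite type \<open>'v\<close>, so that \<open>\<real>\<^bsup>|V|\<^esup>\<close> is \<open>real ^ 'v\<close>.\<close>

abbreviation all_edges :: "'v::finite set set" where
  "all_edges \<equiv> [UNIV]\<^bsup>2\<^esup>"

text \<open>Weights are total functions; only their values on the edge set \<open>E\<close> are ever used.\<close>

definition weighted_graph :: "'v::finite set set \<Rightarrow> ('v set \<Rightarrow> real) \<Rightarrow> bool" where
  "weighted_graph E w \<longleftrightarrow> E \<subseteq> all_edges \<and> (\<forall>e\<in>E. 0 < w e)"

definition outer :: "real ^ 'v \<Rightarrow> real ^ 'v \<Rightarrow> real ^ 'v ^ 'v" where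
  "outer x y = (\<chi> i j. x $ i * y $ j)"

text \<open>The matrix \<open>(e\<^sub>u - e\<^sub>v)(e\<^sub>u - e\<^sub>v)\<^sup>T\<close> of an edge \<open>{u, v}\<close> does not depend on which endpoint
  is called \<open>u\<close>, so the description below is unique; see \<open>edge_matrix_doubleton\<close>.\<close>

definition edge_matrix :: "'v::finite set \<Rightarrow> real ^ 'v ^ 'v" where
  "edge_matrix e = (THE M. \<exists>u v. e = {u, v} \<and>
     M = outer (axis u 1 - axis v 1) (axis u 1 - axis v 1))"

lemma edge_matrix_doubleton:
  "edge_matrix {u, v} = outer (axis u 1 - axis v 1) (axis u 1 - axis v 1)"
proof -
  have swap: "outer (y - x) (y - x) = outer (x - y) (x - y)" for x y :: "real ^ 'a"
    by (simp add: outer_def vec_eq_iff algebra_simps)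
  show ?thesis
    unfolding edge_matrix_def
    by (rule the_equality) (auto simp: doubleton_eq_iff intro: swap)
qed

definition laplacian :: "'v::finite set set \<Rightarrow> ('v set \<Rightarrow> real) \<Rightarrow> real ^ 'v ^ 'v" where
  "laplacian E w = (\<Sum>e\<in>E. w e *\<^sub>R edge_matrix e)"

text \<open>This is \<open>laplacian\<close> of the edge set \<open>all_edges\<close> with unit weights; see \<open>laplacian_all_edges\<close>.\<close>

definition laplacian_complete :: "real ^ 'v::finite ^ 'v" where
  "laplacian_complete = real CARD('v) *\<^sub>R mat 1 - outer 1 1"

definition positive_semidefinite :: "real ^ 'v ^ 'v::finite \<Rightarrow> bool" where
  "positive_semidefinite M \<longleftrightarrow> transpose M = M \<and> (\<forall>x. 0 \<le> x \<bullet> (M *v x))"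

definition loewner_le :: "real ^ 'v ^ 'v::finite \<Rightarrow> real ^ 'v ^ 'v \<Rightarrow> bool"  (infix \<open>\<preceq>\<close> 50) where
  "A \<preceq> B \<longleftrightarrow> positive_semidefinite (B - A)"

definition edge_ordering :: "('v::finite set \<Rightarrow> 'v \<times> 'v) \<Rightarrow> bool" where
  "edge_ordering ends \<longleftrightarrow> (\<forall>e\<in>all_edges. e = {fst (ends e), snd (ends e)})"

text \<open>Functions on \<open>all_edges\<close> are represented with the canonical value \<open>undefined\<close> elsewhere.\<close>

definition edge_function :: "('v::finite set \<Rightarrow> 'v \<times> 'v) \<Rightarrow> real ^ 'v \<Rightarrow> 'v set \<Rightarrow> real" where
  "edge_function ends a =
     (\<lambda>e\<in>all_edges. (a $ fst (ends e) - a $ snd (ends e)) / sqrt (real CARD('v)))"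

definition function_space :: "('v::finite set \<Rightarrow> 'v \<times> 'v) \<Rightarrow> ('v set \<Rightarrow> real) set" where
  "function_space ends = {edge_function ends a | a. (\<Sum>u\<in>UNIV. a $ u) = 0}"

lemma edge_matrix_nth:
  assumes "u \<noteq> v"
  shows "edge_matrix {u, v} $ i $ j =
    (if i = j then of_bool (i \<in> {u, v}) else - of_bool ({i, j} = {u, v}))"
  using assms by (auto simp: edge_matrix_doubleton outer_def axis_def doubleton_eq_iff)

lemma laplacian_all_edges: "laplacian all_edges (\<lambda>_. 1) = (laplacian_complete :: real ^ 'v::finite ^ 'v)"
proof -
  have nth: "edge_matrix e $ i $ j =
      (if i = j then of_bool (i \<in> e) else - of_bool (e = {i, j}))"
    if "e \<in> all_edges" for e and i j :: 'v
  proof -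
    from that obtain u v where "u \<noteq> v" "e = {u, v}"
      by (auto simp: nsets_2_eq)
    then show ?thesis
      using edge_matrix_nth[of u v i j] by (auto simp: doubleton_eq_iff)
  qed
  have star: "card {e \<in> all_edges. i \<in> e} = CARD('v) - 1" for i :: 'v
  proof -
    have "{e \<in> all_edges. i \<in> e} = (\<lambda>x. {i, x}) ` (UNIV - {i})"
      by (auto simp: nsets_2_eq)
    moreover have "inj_on (\<lambda>x. {i, x}) (UNIV - {i})"
      by (auto simp: inj_on_def doubleton_eq_iff)
    ultimately show ?thesis
      by (simp add: card_image card_Diff_singleton)
  qed
  have fin: "finite (all_edges :: 'v set set)"
    by simp
  have "laplacian all_edges (\<lambda>_. 1) $ i $ j = (laplacian_complete :: real ^ 'v ^ 'v) $ i $ j" for i j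
  proof (cases "i = j")
    case True
    have "(\<Sum>e\<in>all_edges. edge_matrix e $ i $ i) = (\<Sum>e\<in>all_edges. of_bool (i \<in> e))"
      by (rule sum.cong) (simp_all add: nth)
    also have "\<dots> = real (card {e \<in> all_edges. i \<in> e})"
      by (simp add: Int_def)
    also have "\<dots> = real CARD('v) - 1"
      unfolding star by (simp add: of_nat_diff Suc_leI)
    finally show ?thesis
      using True by (simp add: laplacian_def laplacian_complete_def outer_def mat_def)
  next
    case False
    then have mem: "{i, j} \<in> all_edges"
      by (simp add: nsets_def)
    have "(\<Sum>e\<in>all_edges. edge_matrix e $ i $ j) = (\<Sum>e\<in>all_edges. if e = {i, j} then -1 else 0)"
      by (rule sum.cong) (use False in \<open>auto simp: nth\<close>)
    also have "\<dots> = -1"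
      using mem fin by (subst sum.delta) auto
    finally show ?thesis
      using False by (simp add: laplacian_def laplacian_complete_def outer_def mat_def)
  qed
  then show ?thesis
    by (simp add: vec_eq_iff)
qed

end

theory Submission
  imports Defs
begin

text \<open>Both conditions compare the same quadratic forms. For \<open>f = edge_function ends a\<close>,
  \<open>a \<bullet> (laplacian E w *v a)\<close> is \<open>CARD('v)\<close> times \<open>\<Sum>e\<in>E. w e * \<bar>f e\<bar>\<^sup>2\<close>
  (lemma \<open>laplacian_form\<close>); taking all edges with unit weights, \<open>a \<bullet> (laplacian_complete *v a)\<close>
  is \<open>CARD('v)\<close> times \<open>(L2_set f all_edges)\<^sup>2\<close>. The Laplacians are symmetric, so the Loewner order
  between their multiples is the order of these forms at every vector \<open>a\<close>. The
  Marcinkiewicz--Zygmund inequality asks for it only at mean-zero \<open>a\<close>, but \<open>f\<close> depends only on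
  differences of entries of \<open>a\<close>, and hence subtracting the mean of \<open>a\<close> loses nothing
  (lemma \<open>function_space_eq_range\<close>).\<close>

lemma edge_orderingD:
  assumes "edge_ordering ends" and "e \<in> all_edges"
  shows "e = {fst (ends e), snd (ends e)}"
  using assms by (simp add: edge_ordering_def)

lemma sum_matrix_vector_mult: "(\<Sum>i\<in>I. A i) *v x = (\<Sum>i\<in>I. A i *v x)"
  by (induction I rule: infinite_finite_induct) (simp_all add: matrix_vector_mult_add_rdistrib)

lemma outer_matrix_vector_mult: "outer x y *v z = (y \<bullet> z) *\<^sub>R x"
  by (simp add: outer_def matrix_vector_mult_def inner_vec_def vec_eq_iff
      sum_distrib_left mult_ac)

lemma edge_matrix_form:
  "x \<bullet> (edge_matrix {u, v} *v x) = (x $ u - x $ v)\<^sup>2"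
  by (simp add: edge_matrix_doubleton outer_matrix_vector_mult inner_diff_left inner_diff_right
      inner_axis inner_axis' power2_eq_square)

lemma transpose_edge_matrix:
  assumes "e \<in> all_edges"
  shows "transpose (edge_matrix e) = edge_matrix e"
  using assms
  by (auto simp: nsets_2_eq edge_matrix_doubleton outer_def transpose_def vec_eq_iff mult.commute)

lemma transpose_laplacian:
  assumes "E \<subseteq> all_edges"
  shows "transpose (laplacian E w) = laplacian E w"
proof -
  have "edge_matrix e $ j $ i = edge_matrix e $ i $ j" if "e \<in> E" for e and i j :: 'a
    using transpose_edge_matrix[of e] that assms by (auto simp: transpose_def vec_eq_iff)
  then show ?thesis
    by (simp add: laplacian_def transpose_def vec_eq_iff)
qed

lemma laplacian_form:
  fixes x :: "real ^ 'v::finite"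
  assumes ends: "edge_ordering ends" and E: "E \<subseteq> all_edges"
  shows "x \<bullet> (laplacian E w *v x) =
    real CARD('v) * (\<Sum>e\<in>E. w e * \<bar>edge_function ends x e\<bar>\<^sup>2)"
proof -
  have "x \<bullet> (w e *\<^sub>R edge_matrix e *v x) =
      real CARD('v) * (w e * \<bar>edge_function ends x e\<bar>\<^sup>2)" if "e \<in> E" for e
  proof -
    have e: "e \<in> all_edges"
      using that E by blast
    have "x \<bullet> (edge_matrix e *v x) = (x $ fst (ends e) - x $ snd (ends e))\<^sup>2"
      by (subst edge_orderingD[OF ends e]) (rule edge_matrix_form)
    then show ?thesis
      using e by (simp add: edge_function_def power_divide flip: scaleR_matrix_vector_assoc)
  qed
  then show ?thesis
    by (simp add: laplacian_def sum_matrix_vector_mult inner_sum_right sum_distrib_left)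
qed

lemma laplacian_complete_form:
  fixes x :: "real ^ 'v::finite"
  assumes "edge_ordering ends"
  shows "x \<bullet> (laplacian_complete *v x) =
    real CARD('v) * (L2_set (edge_function ends x) all_edges)\<^sup>2"
  using laplacian_form[OF assms order_refl, of x "\<lambda>_. 1"]
  by (simp add: laplacian_all_edges L2_set_def sum_nonneg)

lemma transpose_laplacian_complete:
  "transpose laplacian_complete = (laplacian_complete :: real ^ 'v::finite ^ 'v)"
  using transpose_laplacian[OF order_refl, of "\<lambda>_. 1"] by (simp add: laplacian_all_edges)

lemma loewner_le_iff_form:
  assumes "transpose A = A" and "transpose B = B"
  shows "A \<preceq> B \<longleftrightarrow> (\<forall>x. x \<bullet> (A *v x) \<le> x \<bullet> (B *v x))"
proof -
  have "transpose (B - A) = B - A"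
    using assms by (simp add: transpose_def vec_eq_iff)
  then show ?thesis
    by (simp add: loewner_le_def positive_semidefinite_def
        matrix_vector_mult_diff_rdistrib inner_diff_right)
qed

lemma edge_function_shift: "edge_function ends (\<chi> u. a $ u - c) = edge_function ends a"
  by (simp add: edge_function_def)

lemma function_space_eq_range:
  fixes ends :: "'v::finite set \<Rightarrow> 'v \<times> 'v"
  shows "function_space ends = range (edge_function ends)"
proof -
  have "edge_function ends a \<in> function_space ends" for a
  proof -
    define b where "b = (\<chi> u. a $ u - (\<Sum>v\<in>UNIV. a $ v) / real CARD('v))"
    have "(\<Sum>u\<in>UNIV. b $ u) = 0"
      by (simp add: b_def sum_subtractf)
    moreover have "edge_function ends a = edge_function ends b"
      by (simp add: b_def edge_function_shift)
    ultimately show ?thesis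
      by (auto simp: function_space_def)
  qed
  then show ?thesis
    by (auto simp: function_space_def)
qed

theorem proposition4p4:
  fixes E :: "'v::finite set set" and w :: "'v set \<Rightarrow> real"
    and ends :: "'v set \<Rightarrow> 'v \<times> 'v" and \<epsilon> :: real
  assumes "3 \<le> CARD('v)"
    and "weighted_graph E w"
    and "edge_ordering ends"
    and "0 \<le> \<epsilon>" and "\<epsilon> < 1"
  shows "((1 - \<epsilon>) *\<^sub>R laplacian_complete \<preceq> laplacian E w \<and>
          laplacian E w \<preceq> (1 + \<epsilon>) *\<^sub>R laplacian_complete) \<longleftrightarrow>
    (\<forall>f \<in> function_space ends.
       (1 - \<epsilon>) * (L2_set f all_edges)\<^sup>2 \<le> (\<Sum>e\<in>E. w e * \<bar>f e\<bar>\<^sup>2) \<and>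
       (\<Sum>e\<in>E. w e * \<bar>f e\<bar>\<^sup>2) \<le> (1 + \<epsilon>) * (L2_set f all_edges)\<^sup>2)"
proof -
  have E: "E \<subseteq> all_edges"
    using assms(2) by (simp add: weighted_graph_def)
  define Q where "Q a = (\<Sum>e\<in>E. w e * \<bar>edge_function ends a e\<bar>\<^sup>2)" for a
  define N where "N a = (L2_set (edge_function ends a) all_edges)\<^sup>2" for a
  have G: "a \<bullet> (laplacian E w *v a) = real CARD('v) * Q a" for a
    unfolding Q_def by (rule laplacian_form[OF assms(3) E])
  have K: "a \<bullet> ((c *\<^sub>R laplacian_complete) *v a) = real CARD('v) * (c * N a)" for a c
    using laplacian_complete_form[OF assms(3), of a]
    by (simp add: N_def flip: scaleR_matrix_vector_assoc)
  have symG: "transpose (laplacian E w) = laplacian E w"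
    by (rule transpose_laplacian[OF E])
  have symK: "transpose (c *\<^sub>R laplacian_complete) = (c *\<^sub>R laplacian_complete :: real ^ 'v ^ 'v)" for c
    by (simp add: transpose_scalar transpose_laplacian_complete)
  have lower: "(1 - \<epsilon>) *\<^sub>R laplacian_complete \<preceq> laplacian E w \<longleftrightarrow> (\<forall>a. (1 - \<epsilon>) * N a \<le> Q a)"
    by (simp only: loewner_le_iff_form[OF symK symG] G K) simp
  have upper: "laplacian E w \<preceq> (1 + \<epsilon>) *\<^sub>R laplacian_complete \<longleftrightarrow> (\<forall>a. Q a \<le> (1 + \<epsilon>) * N a)"
    by (simp only: loewner_le_iff_form[OF symG symK] G K) simp
  show ?thesis
    unfolding lower upper function_space_eq_range by (auto simp: Q_def N_def)
qed

end
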